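(* Let $A,B$ be two abelian groups, let $\phi\colon A\to B$ be a group homomorphism, let $\Lambda$ be a lattice and $f\colon\Lambda\to A$ any function, and let $K_f$, $K_{\phi\circ f}$ be the corresponding rings with duality valued in $A$ and $B$ respectively. Then there exists a group homomorphism $\pi\colon K_f\to K_{\phi\circ f}$ such that \[ \phi(\langle x,y\rangle_f)=\langle\pi(x),\pi(y)\rangle_{\phi\circ f}\qquad\text{for every }x,y\in K_f. \]
   Context: A lattice is a free abelian group, possibly of infinite rank. $\mathrm{Sh}(\Lambda)=\mathbb{Z}[\Lambda]$ is the group ring, acting on functions from $\Lambda$ to an abelian group by $(t\cdot f)(x)=\sum_ia_if(x+\lambda_i)$ for $t=\sum_ia_i\lambda_i$. For a function $f$ on $\Lambda$ with values in an abelian group $A$, $\mathrm{Ann}(f)=\{s\in\mathrm{Sh}(\Lambda)\mid s\cdot f\equiv0\}$, $K_f=\mathrm{Sh}(\Lambda)/\mathrm{Ann}(f)$, and $K_f$ carries the $A$-valued pairing $\langle[s],[t]\rangle_f=((st)\cdot f)(0)$. *)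

theory Defs
  imports
    "HOL-Algebra.Algebraic_Closure_Type"
    "HOL-Algebra.Free_Abelian_Groups"
    "HOL-Algebra.QuotRing"
begin

section \<open>Abelian groups and lattices\<close>

definition additive_group :: "'a::ab_group_add monoid" where
  "additive_group = \<lparr>carrier = UNIV, monoid.mult = (+), one = 0\<rparr>"

definition zsmult :: "int \<Rightarrow> 'a \<Rightarrow> 'a::ab_group_add" (infixr \<open>*\<^sub>Z\<close> 75) where
  "n *\<^sub>Z a = a [^]\<^bsub>additive_group\<^esub> n"

text \<open>
  Asking the index set \<open>B\<close> to be a subset of the group itself is no restriction: replace an
  arbitrary index set by the image of its generators. \<open>B\<close> may be infinite.
\<close>

definition is_lattice :: "'l::ab_group_add itself \<Rightarrow> bool" where
  "is_lattice _ \<longleftrightarrow> (\<exists>B::'l set. free_Abelian_group B \<cong> (additive_group :: 'l monoid))"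

lemma additive_group_simps [simp]:
  "carrier additive_group = UNIV" "x \<otimes>\<^bsub>additive_group\<^esub> y = x + y" "\<one>\<^bsub>additive_group\<^esub> = 0"
  by (simp_all add: additive_group_def)

lemma comm_group_additive_group: "comm_group (additive_group :: 'a::ab_group_add monoid)"
proof (rule comm_groupI)
  fix x :: 'a
  have "- x + x = 0" by simp
  then show "\<exists>y\<in>carrier additive_group. y \<otimes>\<^bsub>additive_group\<^esub> x = \<one>\<^bsub>additive_group\<^esub>"
    by (metis UNIV_I additive_group_simps)
qed (auto simp: ac_simps)

interpretation additive_group: comm_group "additive_group :: 'a::ab_group_add monoid"
  by (rule comm_group_additive_group)

lemma inv_additive_group [simp]: "inv\<^bsub>additive_group\<^esub> x = - (x :: 'a::ab_group_add)"
  by (rule additive_group.inv_equality) auto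

lemma zsmult_0_left [simp]: "0 *\<^sub>Z a = 0"
  and zsmult_1_left [simp]: "1 *\<^sub>Z a = a"
  and zsmult_diff_left: "(m - n) *\<^sub>Z a = m *\<^sub>Z a - n *\<^sub>Z a"
  and zsmult_add_right: "n *\<^sub>Z (a + b) = n *\<^sub>Z a + n *\<^sub>Z b"
proof -
  show "0 *\<^sub>Z a = 0" "1 *\<^sub>Z a = a"
    by (simp_all add: zsmult_def)
  show "(m - n) *\<^sub>Z a = m *\<^sub>Z a - n *\<^sub>Z a"
    using additive_group.int_pow_diff[of a m n] by (simp add: zsmult_def)
  show "n *\<^sub>Z (a + b) = n *\<^sub>Z a + n *\<^sub>Z b"
    using additive_group.int_pow_distrib[of a b n] by (simp add: zsmult_def)
qed

lemma additive_zsmult: "Modules.additive (\<lambda>a. n *\<^sub>Z a)"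
  by (rule additive.intro) (rule zsmult_add_right)

section \<open>The group ring and its action on functions\<close>

text \<open>
  Multiplication on \<open>'l \<Rightarrow>\<^sub>0 int\<close> is convolution, so this type is the group ring of \<open>'l\<close>
  over the integers.
\<close>

type_synonym 'l Sh = "'l \<Rightarrow>\<^sub>0 int"

definition Sh_ring :: "('l::ab_group_add) Sh ring" where
  "Sh_ring = ring_of_type_algebra"

definition act :: "'l Sh \<Rightarrow> ('l \<Rightarrow> 'a) \<Rightarrow> 'l::ab_group_add \<Rightarrow> 'a::ab_group_add" where
  "act t f x = (\<Sum>l\<in>Poly_Mapping.keys t. Poly_Mapping.lookup t l *\<^sub>Z f (x + l))"

definition Ann :: "('l::ab_group_add \<Rightarrow> 'a::ab_group_add) \<Rightarrow> 'l Sh set" where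
  "Ann f = {s. \<forall>x. act s f x = 0}"

definition K :: "('l::ab_group_add \<Rightarrow> 'a::ab_group_add) \<Rightarrow> 'l Sh set ring" where
  "K f = Sh_ring Quot Ann f"

text \<open>Elements of \<open>K f\<close> are cosets; well-definedness is \<open>pairing_coset\<close> below.\<close>

definition pairing ::
  "('l::ab_group_add \<Rightarrow> 'a::ab_group_add) \<Rightarrow> 'l Sh set \<Rightarrow> 'l Sh set \<Rightarrow> 'a" where
  "pairing f x y = (THE a. \<forall>s\<in>x. \<forall>t\<in>y. a = act (s * t) f 0)"

section \<open>Well-definedness\<close>

lemma act_superset:
  assumes "finite S" "Poly_Mapping.keys t \<subseteq> S"
  shows "act t f x = (\<Sum>l\<in>S. Poly_Mapping.lookup t l *\<^sub>Z f (x + l))"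
  unfolding act_def using assms
  by (intro sum.mono_neutral_left) (auto simp: in_keys_iff)

lemma act_0_left [simp]: "act 0 f x = 0"
  by (simp add: act_def)

lemma act_diff_left: "act (s - t) f x = act s f x - act t f x"
proof -
  let ?S = "Poly_Mapping.keys s \<union> Poly_Mapping.keys t"
  have "Poly_Mapping.keys (s - t) \<subseteq> ?S"
    by (rule keys_diff)
  then show ?thesis
    by (simp add: act_superset[of ?S] lookup_minus zsmult_diff_left sum_subtractf)
qed

lemma act_add_left: "act (s + t) f x = act s f x + act t f x"
  using act_diff_left[of "s + t" t f x] by simp

lemma act_0_right [simp]: "act t (\<lambda>_. 0) x = 0"
  by (simp add: act_def additive.zero[OF additive_zsmult])

lemma act_diff_right: "act t (\<lambda>y. f y - g y) x = act t f x - act t g x"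
  by (simp add: act_def additive.diff[OF additive_zsmult] sum_subtractf)

lemma act_frag_of [simp]: "act (frag_of l) f x = f (x + l)"
  by (simp add: act_def)

lemma act_mult: "act (s * t) f = act s (act t f)"
proof -
  have *: "act (frag_of l * t) f x = act t f (x + l)" for l x
  proof (rule frag_induction[of t UNIV])
    show "act (frag_of l * frag_of k) f x = act (frag_of k) f (x + l)" for k
    proof -
      have "frag_of l * frag_of k = frag_of (l + k)"
        by (simp add: mult_single)
      then show ?thesis
        by (simp add: add.assoc)
    qed
  qed (auto simp: right_diff_distrib act_diff_left)
  show ?thesis
  proof
    fix x
    show "act (s * t) f x = act s (act t f) x"
      by (rule frag_induction[of s UNIV]) (auto simp: left_diff_distrib act_diff_left *)
  qed
qed

lemma cring_Sh_ring: "cring (Sh_ring :: ('l::ab_group_add) Sh ring)"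
  unfolding Sh_ring_def by (rule cring_from_type_algebra)

lemma Sh_ring_simps [simp]:
  "carrier Sh_ring = UNIV" "s \<oplus>\<^bsub>Sh_ring\<^esub> t = s + t" "s \<otimes>\<^bsub>Sh_ring\<^esub> t = s * t"
  "\<zero>\<^bsub>Sh_ring\<^esub> = 0" "\<one>\<^bsub>Sh_ring\<^esub> = 1"
  by (simp_all add: Sh_ring_def ring_of_type_algebra_def)

lemma ideal_Ann: "ideal (Ann f) Sh_ring"
proof -
  interpret cring "Sh_ring :: 'a Sh ring"
    by (rule cring_Sh_ring)
  have neg: "- s \<in> Ann f" if "s \<in> Ann f" for s
    using that act_diff_left[of 0 s f] by (simp add: Ann_def)
  have inv: "inv\<^bsub>add_monoid Sh_ring\<^esub> s = - s" for s :: "'a Sh"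
    using minus_equality[of "- s" s] by (simp add: a_inv_def)
  have l: "t * s \<in> Ann f" if "s \<in> Ann f" for s t
  proof -
    have "act s f = (\<lambda>_. 0)"
      using that by (auto simp: Ann_def)
    then show ?thesis
      by (simp add: Ann_def act_mult)
  qed
  show ?thesis
  proof (rule idealI)
    show "ring (Sh_ring :: 'a Sh ring)"
      by (rule ring_axioms)
    show "subgroup (Ann f) (add_monoid Sh_ring)"
    proof (rule subgroup.intro)
      show "inv\<^bsub>add_monoid Sh_ring\<^esub> s \<in> Ann f" if "s \<in> Ann f" for s
        using neg[OF that] by (simp only: inv)
    qed (auto simp: Ann_def act_add_left)
  qed (use l in \<open>auto simp: mult.commute\<close>)
qed

lemma cring_K: "cring (K f)"
  unfolding K_def by (rule ideal.quotient_is_cring[OF ideal_Ann cring_Sh_ring])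

lemma mem_coset_iff: "s' \<in> Ann f +>\<^bsub>Sh_ring\<^esub> s \<longleftrightarrow> s' - s \<in> Ann f"
  by (auto simp: a_r_coset_def' image_iff intro: bexI[where x = "s' - s"])

lemma carrier_K: "carrier (K f) = range (\<lambda>s. Ann f +>\<^bsub>Sh_ring\<^esub> s)"
  by (auto simp: K_def FactRing_def A_RCOSETS_def')

lemma pairing_coset:
  "pairing f (Ann f +>\<^bsub>Sh_ring\<^esub> s) (Ann f +>\<^bsub>Sh_ring\<^esub> t) = act (s * t) f 0"
proof -
  interpret ideal "Ann f" Sh_ring
    by (rule ideal_Ann)
  have wd: "act (s' * t') f 0 = act (s * t) f 0"
    if "s' - s \<in> Ann f" "t' - t \<in> Ann f" for s' t'
  proof -
    have "(s' - s) * t' + s * (t' - t) \<in> Ann f"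
      using that I_l_closed[of "t' - t" s] I_r_closed[of "s' - s" t']
        additive_subgroup.a_closed[OF is_additive_subgroup, of "(s' - s) * t'" "s * (t' - t)"]
      by simp
    then have "s' * t' - s * t \<in> Ann f"
      by (simp add: algebra_simps)
    then show ?thesis
      by (simp add: Ann_def act_diff_left)
  qed
  have refl: "u - u \<in> Ann f" for u
    by (simp add: Ann_def)
  show ?thesis
    unfolding pairing_def
  proof (rule the_equality)
    show "\<forall>s'\<in>Ann f +>\<^bsub>Sh_ring\<^esub> s. \<forall>t'\<in>Ann f +>\<^bsub>Sh_ring\<^esub> t. act (s * t) f 0 = act (s' * t') f 0"
      by (metis mem_coset_iff wd)
    show "a = act (s * t) f 0"
      if "\<forall>s'\<in>Ann f +>\<^bsub>Sh_ring\<^esub> s. \<forall>t'\<in>Ann f +>\<^bsub>Sh_ring\<^esub> t. a = act (s' * t') f 0" for a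
      using that refl mem_coset_iff by blast
  qed
qed

end

theory Submission
  imports Defs
begin

text \<open>
  A homomorphism commutes with integer multiples, so it commutes with the action:
  \<open>t \<cdot> (\<phi> \<circ> f) = \<phi> \<circ> (t \<cdot> f)\<close> (lemma \<open>act_comp\<close>). Hence \<open>Ann f \<subseteq> Ann (\<phi> \<circ> f)\<close>, and the identity of
  the group ring descends to a map \<open>[s] \<mapsto> [s]\<close> from \<open>K f\<close> to \<open>K (\<phi> \<circ> f)\<close>. Evaluating the
  commutation identity for \<open>s * t\<close> at \<open>0\<close> gives the compatibility of the two pairings.
\<close>

lemma additive_zsmult_commute:
  assumes "Modules.additive \<phi>"
  shows "\<phi> (n *\<^sub>Z a) = n *\<^sub>Z \<phi> a"
proof -
  have "\<phi> \<in> hom additive_group additive_group"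
    by (simp add: hom_def additive.add[OF assms])
  then show ?thesis
    unfolding zsmult_def
    by (intro hom_int_pow) (simp_all add: additive_group.is_group)
qed

lemma act_comp:
  assumes "Modules.additive \<phi>"
  shows "act t (\<phi> \<circ> f) x = \<phi> (act t f x)"
  by (simp add: act_def additive.sum[OF assms] additive_zsmult_commute[OF assms])

lemma Ann_comp_mono:
  assumes "Modules.additive \<phi>"
  shows "Ann f \<subseteq> Ann (\<phi> \<circ> f)"
  by (auto simp: Ann_def act_comp[OF assms] additive.zero[OF assms])

lemma add_coset_Ann:
  "(Ann f +>\<^bsub>Sh_ring\<^esub> s) \<oplus>\<^bsub>K f\<^esub> (Ann f +>\<^bsub>Sh_ring\<^esub> t) = Ann f +>\<^bsub>Sh_ring\<^esub> (s + t)"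
proof -
  interpret ideal "Ann f" Sh_ring
    by (rule ideal_Ann)
  show ?thesis
    using a_rcos_sum[of s t] by (simp add: K_def FactRing_def)
qed

text \<open>
  The map sending \<open>[s]\<close> to \<open>[s]\<close>, from cosets of one annihilator to cosets of the annihilator of
  \<open>g\<close>. Taking everything congruent modulo \<open>Ann g\<close> to some element of \<open>C\<close> avoids choosing a
  representative; the result is a single coset as soon as the first annihilator is contained in
  the second.
\<close>

definition K_proj :: "('l::ab_group_add \<Rightarrow> 'b::ab_group_add) \<Rightarrow> 'l Sh set \<Rightarrow> 'l Sh set" where
  "K_proj g C = {u. \<exists>t\<in>C. u - t \<in> Ann g}"

lemma K_proj_coset:
  assumes "Ann f \<subseteq> Ann g"
  shows "K_proj g (Ann f +>\<^bsub>Sh_ring\<^esub> s) = Ann g +>\<^bsub>Sh_ring\<^esub> s"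
proof -
  have "u - s \<in> Ann g" if "u - t \<in> Ann g" "t - s \<in> Ann f" for u t
  proof -
    have "act (u - s) g x = act (u - t) g x + act (t - s) g x" for x
      using act_add_left[of "u - t" "t - s" g x] by simp
    then show ?thesis
      using that assms by (auto simp: Ann_def)
  qed
  moreover have "s - s \<in> Ann f"
    by (simp add: Ann_def)
  ultimately show ?thesis
    unfolding K_proj_def by (auto simp: mem_coset_iff)
qed

lemma K_proj_hom:
  assumes "Ann f \<subseteq> Ann g"
  shows "K_proj g \<in> hom (add_monoid (K f)) (add_monoid (K g))"
  by (rule homI) (auto simp: carrier_K K_proj_coset[OF assms] add_coset_Ann)

theorem proposition2p12:
  fixes \<phi> :: "'a::ab_group_add \<Rightarrow> 'b::ab_group_add"
    and f :: "'l::ab_group_add \<Rightarrow> 'a"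
  assumes "is_lattice TYPE('l)"
    and "Modules.additive \<phi>"
  shows "\<exists>\<pi> \<in> hom (add_monoid (K f)) (add_monoid (K (\<phi> \<circ> f))).
           \<forall>x \<in> carrier (K f). \<forall>y \<in> carrier (K f).
             \<phi> (pairing f x y) = pairing (\<phi> \<circ> f) (\<pi> x) (\<pi> y)"
proof (intro bexI ballI)
  note le = Ann_comp_mono[OF assms(2), of f]
  show "K_proj (\<phi> \<circ> f) \<in> hom (add_monoid (K f)) (add_monoid (K (\<phi> \<circ> f)))"
    by (rule K_proj_hom[OF le])
  fix x y
  assume "x \<in> carrier (K f)" "y \<in> carrier (K f)"
  then obtain s t where "x = Ann f +>\<^bsub>Sh_ring\<^esub> s" "y = Ann f +>\<^bsub>Sh_ring\<^esub> t"
    by (auto simp: carrier_K)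
  then show "\<phi> (pairing f x y) = pairing (\<phi> \<circ> f) (K_proj (\<phi> \<circ> f) x) (K_proj (\<phi> \<circ> f) y)"
    by (simp only: K_proj_coset[OF le] pairing_coset act_comp[OF assms(2)])
qed

end
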